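(* Let $A\in\mathbb{K}^{m\times n}$, let $A=U\Sigma V^*$ be a singular value decomposition of $A$, let $r=\operatorname{rank}A$, and let $I\subset\{1,\ldots,r\}$ be a non-empty subset. Let $X=V_I$ and $Y=U_I$. Then \[AX(Y^*AX)^+Y^*A=\sum_{i\in I}\sigma_i u_i v_i^*.\] In particular, \[A-AX(Y^*AX)^+Y^*A=\sum_{i\in\{1,\ldots,r\}\setminus I}\sigma_i u_i v_i^*.\]
   Context: $\mathbb{K}=\mathbb{R}$ or $\mathbb{K}=\mathbb{C}$; $M^*$ is the conjugate transpose and $M^+$ the Moore--Penrose pseudoinverse of $M$. In the singular value decomposition $A=U\Sigma V^*$, the matrices $U\in\mathbb{K}^{m\times m}$ and $V\in\mathbb{K}^{n\times n}$ are unitary (orthogonal if $\mathbb{K}=\mathbb{R}$), and $\Sigma$ is an $m\times n$ real non-negative generalized diagonal matrix with decreasing (non-increasing) diagonal entries $\sigma_1\ge\sigma_2\ge\cdots$. The columns of $U$ and $V$ are denoted $u_i$ and $v_i$. For $I=\{i_1<\dots<i_k\}$, $U_I$ and $V_I$ denote the submatrices of $U$ and $V$ consisting of the columns with indices in $I$. *)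

theory Defs
  imports
    "Jordan_Normal_Form.Schur_Decomposition"
    "Jordan_Normal_Form.DL_Rank"
    "Jordan_Normal_Form.DL_Submatrix"
begin

(* The definitions are used at 'a = real (where conjugate is the identity, so that unitary
   means orthogonal) and at 'a = complex (where conjugate = cnj).  Matrix indices start at 0. *)

definition unitary_mat :: "nat \<Rightarrow> 'a :: conjugatable_field mat \<Rightarrow> bool" where
  "unitary_mat n U \<longleftrightarrow>
     U \<in> carrier_mat n n \<and> mat_adjoint U * U = 1\<^sub>m n \<and> U * mat_adjoint U = 1\<^sub>m n"

definition is_svd ::
  "'a :: {conjugatable_field, real_algebra_1} mat \<Rightarrow> 'a mat \<Rightarrow> real mat \<Rightarrow> 'a mat \<Rightarrow> bool" where
  "is_svd A U S V \<longleftrightarrow>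
     unitary_mat (dim_row A) U \<and> unitary_mat (dim_col A) V \<and>
     S \<in> carrier_mat (dim_row A) (dim_col A) \<and> diagonal_mat S \<and>
     (\<forall>i < min (dim_row A) (dim_col A). 0 \<le> S $$ (i, i)) \<and>
     (\<forall>i j. i \<le> j \<longrightarrow> j < min (dim_row A) (dim_col A) \<longrightarrow> S $$ (j, j) \<le> S $$ (i, i)) \<and>
     A = U * map_mat of_real S * mat_adjoint V"

text \<open>The four Penrose equations.\<close>

definition penrose_inverse :: "'a :: conjugatable_field mat \<Rightarrow> 'a mat \<Rightarrow> bool" where
  "penrose_inverse M Z \<longleftrightarrow>
     Z \<in> carrier_mat (dim_col M) (dim_row M) \<and>
     M * Z * M = M \<and> Z * M * Z = Z \<and>
     mat_adjoint (M * Z) = M * Z \<and> mat_adjoint (Z * M) = Z * M"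

definition pinv :: "'a :: conjugatable_field mat \<Rightarrow> 'a mat" where
  "pinv M = (THE Z. penrose_inverse M Z)"

text \<open>The matrix \<open>u v\<^sup>*\<close> for column vectors \<open>u\<close> and \<open>v\<close>.\<close>

definition outer_prod :: "'a :: conjugatable_field vec \<Rightarrow> 'a vec \<Rightarrow> 'a mat" where
  "outer_prod u v = mat_of_cols (dim_vec u) [u] * mat_adjoint (mat_of_cols (dim_vec v) [v])"

lemma mat_adjoint_dim [simp]:
  "dim_row (mat_adjoint A) = dim_col A" "dim_col (mat_adjoint A) = dim_row A"
  unfolding mat_adjoint_def by auto

lemma mat_adjoint_index [simp]:
  "i < dim_col A \<Longrightarrow> j < dim_row A \<Longrightarrow> mat_adjoint A $$ (i, j) = conjugate (A $$ (j, i))"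
  unfolding mat_adjoint_def by (simp add: mat_of_rows_def)

lemma mat_adjoint_mult:
  fixes A B :: "'a :: conjugatable_field mat"
  assumes "dim_col A = dim_row B"
  shows "mat_adjoint (A * B) = mat_adjoint B * mat_adjoint A"
  using assms
  by (intro eq_matI)
     (auto simp: scalar_prod_def sum_conjugate conjugate_dist_mul mult.commute intro!: sum.cong)

lemma penrose_inverse_unique:
  fixes M :: "'a :: conjugatable_field mat"
  assumes Z: "penrose_inverse M Z" and W: "penrose_inverse M W"
  shows "Z = W"
proof -
  define m n where "m = dim_row M" and "n = dim_col M"
  have [simp]: "M \<in> carrier_mat m n" "Z \<in> carrier_mat n m" "W \<in> carrier_mat n m"
    using Z W by (auto simp: penrose_inverse_def m_def n_def)
  have d [simp]: "dim_row M = m" "dim_col M = n" "dim_row Z = n" "dim_col Z = m"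
    "dim_row W = n" "dim_col W = m"
    using Z W by (auto simp: penrose_inverse_def m_def n_def)
  note assoc = assoc_mult_mat[where 'a = 'a]
  have MZW: "M * Z = M * W"
  proof -
    have "M * Z = (M * W * M) * Z" using W by (simp add: penrose_inverse_def)
    also have "\<dots> = (M * W) * (M * Z)"
      by (rule assoc[of _ m m _ n _ m]) auto
    also have "\<dots> = mat_adjoint (M * W) * mat_adjoint (M * Z)"
      using Z W by (simp add: penrose_inverse_def)
    also have "\<dots> = mat_adjoint ((M * Z) * (M * W))" by (simp add: mat_adjoint_mult)
    also have "(M * Z) * (M * W) = (M * Z * M) * W"
      by (rule assoc[of _ m m _ n _ m, symmetric]) auto
    also have "mat_adjoint \<dots> = M * W" using Z W by (simp add: penrose_inverse_def)
    finally show ?thesis .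
  qed
  have ZWM: "Z * M = W * M"
  proof -
    have "Z * M = Z * (M * W * M)" using W by (simp add: penrose_inverse_def)
    also have "M * W * M = M * (W * M)"
      by (rule assoc[of _ m n _ m _ n]) auto
    also have "Z * (M * (W * M)) = (Z * M) * (W * M)"
      by (rule assoc[of _ n m _ n _ n, symmetric]) auto
    also have "\<dots> = mat_adjoint (Z * M) * mat_adjoint (W * M)"
      using Z W by (simp add: penrose_inverse_def)
    also have "\<dots> = mat_adjoint ((W * M) * (Z * M))" by (simp add: mat_adjoint_mult)
    also have "(W * M) * (Z * M) = W * (M * (Z * M))"
      by (rule assoc[of _ n m _ n _ n]) auto
    also have "M * (Z * M) = M * Z * M"
      by (rule assoc[of _ m n _ m _ n, symmetric]) auto
    also have "mat_adjoint (W * (M * Z * M)) = W * M" using Z W by (simp add: penrose_inverse_def)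
    finally show ?thesis .
  qed
  have "Z = Z * M * Z" using Z by (simp add: penrose_inverse_def)
  also have "\<dots> = W * M * Z" by (simp add: ZWM)
  also have "\<dots> = W * (M * Z)" by (rule assoc[of _ n m _ n _ m]) auto
  also have "\<dots> = W * (M * W)" by (simp add: MZW)
  also have "\<dots> = W * M * W" by (rule assoc[of _ n m _ n _ m, symmetric]) auto
  also have "\<dots> = W" using W by (simp add: penrose_inverse_def)
  finally show ?thesis .
qed

lemma pinv_eqI: "penrose_inverse M Z \<Longrightarrow> pinv M = Z"
  unfolding pinv_def by (blast intro: the_equality penrose_inverse_unique)

end

theory Submission
  imports Defs
begin

text \<open>
  Write \<open>X = V\<^sub>I\<close>, \<open>Y = U\<^sub>I\<close> and let \<open>D\<close> be the diagonal matrix of the \<open>\<sigma>\<^sub>i\<close> with \<open>i \<in> I\<close>.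
  The singular vectors satisfy \<open>A X = Y D\<close> and \<open>Y\<^sup>* A = D X\<^sup>*\<close>, and \<open>Y\<^sup>* Y = 1\<close> by unitarity, so
  \<open>Y\<^sup>* A X = D\<close>.  All singular values selected by \<open>I\<close> are nonzero; hence \<open>D\<close> is invertible, its
  pseudoinverse is its inverse, and the product collapses to
  \<open>Y D D\<^sup>-\<^sup>1 D X\<^sup>* = Y D X\<^sup>*\<close>, which is the partial sum over \<open>I\<close> of the terms
  \<open>\<sigma>\<^sub>i u\<^sub>i v\<^sub>i\<^sup>*\<close> (\<open>partial_sum_eq_finsum\<close>).

  What has to be proved about the rank is that the indices below it are exactly those of the
  nonzero singular values (\<open>support_eq\<close>).  Let \<open>K\<close> be the set of the latter.  The
  identities \<open>A = U\<^sub>K (D\<^sub>K V\<^sub>K\<^sup>*)\<close> and \<open>U\<^sub>K = A (V\<^sub>K D\<^sub>K\<^sup>-\<^sup>1)\<close> show that \<open>A\<close> and \<open>U\<^sub>K\<close> have the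
  same column space, and the columns of \<open>U\<^sub>K\<close> are orthonormal, so the rank is \<open>card K\<close>; as the
  singular values decrease, \<open>K\<close> is an initial segment of the natural numbers.  The first of these
  identities also expresses \<open>A\<close> as the partial sum over \<open>K\<close>, and subtracting the partial sum
  over \<open>I\<close> gives the second claim.

  The real and the complex case are treated at once, in a field with a conjugation that contains
  the real numbers.
\<close>

section \<open>Submatrices of selected columns\<close>

lemma bij_betw_pick:
  assumes "finite I"
  shows "bij_betw (pick I) {..<card I} I"
proof -
  have "inj_on (pick I) {..<card I}"
    by (rule inj_onI) (metis card_pick_le lessThan_iff)
  moreover have "pick I ` {..<card I} \<subseteq> I"
    by (auto intro: pick_in_set_le)
  ultimately show ?thesis
    using assms by (simp add: bij_betw_def card_image card_subset_eq)
qed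

lemma submatrix_cols_eq:
  assumes "M \<in> carrier_mat n k" and "I \<subseteq> {..<k}"
  shows "submatrix M UNIV I = mat n (card I) (\<lambda>(i, j). M $$ (i, pick I j))"
proof -
  have "{j. j < k \<and> j \<in> I} = I" using assms(2) by auto
  then show ?thesis using assms(1) by (simp add: submatrix_def pick_UNIV)
qed

lemma pick_lt:
  assumes "I \<subseteq> {..<k}" and "a < card I"
  shows "pick I a < k"
  using pick_in_set_le[OF assms(2)] assms(1) by auto

lemma unitary_cols_orthonormal:
  fixes U :: "'a :: conjugatable_field mat"
  assumes U: "unitary_mat n U" and I: "I \<subseteq> {..<n}"
  shows "mat_adjoint (submatrix U UNIV I) * submatrix U UNIV I = 1\<^sub>m (card I)"
proof (rule eq_matI)
  have Uc [simp]: "dim_row U = n" "dim_col U = n" "U \<in> carrier_mat n n"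
    using U by (auto simp: unitary_mat_def)
  note sub = submatrix_cols_eq[OF Uc(3) I]
  fix a b assume "a < dim_row (1\<^sub>m (card I) :: 'a mat)" "b < dim_col (1\<^sub>m (card I) :: 'a mat)"
  then have ab: "a < card I" "b < card I" by auto
  note p = pick_lt[OF I ab(1)] pick_lt[OF I ab(2)]
  have "pick I a = pick I b \<longleftrightarrow> a = b"
    using ab by (metis card_pick_le)
  moreover have "(mat_adjoint U * U) $$ (pick I a, pick I b)
      = (mat_adjoint (submatrix U UNIV I) * submatrix U UNIV I) $$ (a, b)"
    using ab p by (auto simp: sub scalar_prod_def intro!: sum.cong)
  moreover have "mat_adjoint U * U = 1\<^sub>m n" using U by (simp add: unitary_mat_def)
  ultimately show "(mat_adjoint (submatrix U UNIV I) * submatrix U UNIV I) $$ (a, b)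
      = 1\<^sub>m (card I) $$ (a, b)"
    using ab p by simp
qed (use assms in \<open>auto simp: unitary_mat_def submatrix_cols_eq\<close>)

section \<open>Pseudoinverse of an invertible matrix\<close>

lemma mat_adjoint_one: "mat_adjoint (1\<^sub>m k) = (1\<^sub>m k :: 'a :: conjugatable_field mat)"
proof (rule eq_matI)
  have "conjugate (1 :: 'a) * conjugate 1 = conjugate 1"
    by (simp flip: conjugate_dist_mul)
  then have "conjugate (1 :: 'a) = 1" by simp
  then show "mat_adjoint (1\<^sub>m k) $$ (i, j) = (1\<^sub>m k :: 'a mat) $$ (i, j)"
    if "i < dim_row (1\<^sub>m k :: 'a mat)" "j < dim_col (1\<^sub>m k :: 'a mat)" for i j
    using that by auto
qed auto

lemma pinv_eq_inverse:
  fixes D :: "'a :: conjugatable_field mat"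
  assumes "D \<in> carrier_mat k k" "E \<in> carrier_mat k k" and "D * E = 1\<^sub>m k" "E * D = 1\<^sub>m k"
  shows "pinv D = E"
  using assms by (intro pinv_eqI) (simp add: penrose_inverse_def mat_adjoint_one)

section \<open>Column spaces and rank\<close>

lemma (in vec_space) col_space_mult_subset:
  assumes B: "B \<in> carrier_mat n k" and C: "C \<in> carrier_mat k l"
  shows "span (set (cols (B * C))) \<subseteq> span (set (cols B))"
proof -
  have "col (B * C) j \<in> span (set (cols B))" if j: "j < l" for j
  proof -
    have "col (B * C) j = B *\<^sub>v col C j" by (rule col_mult2[OF B C j])
    moreover have "B *\<^sub>v col C j \<in> col_space B"
      using B C j by (auto simp: col_space_eq[OF B])
    ultimately show ?thesis by (simp add: col_space_def)
  qed
  then have "set (cols (B * C)) \<subseteq> span (set (cols B))"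
    using C by (auto simp: cols_def)
  moreover have "set (cols B) \<subseteq> carrier_vec n"
    using cols_dim[of B] B by simp
  ultimately show ?thesis by (rule span_subsetI[rotated])
qed

text \<open>A matrix with a left inverse has a trivial kernel, and its columns are pairwise distinct
  because those of the identity matrix are.\<close>

lemma (in vec_space) rank_left_invertible:
  assumes B: "B \<in> carrier_mat n k" and L: "L \<in> carrier_mat k n" and LB: "L * B = 1\<^sub>m k"
  shows "rank B = k"
proof (rule lin_indpt_full_rank[OF B])
  have "inj_on (col B) {..<k}"
  proof (rule inj_onI)
    fix i j assume ij: "i \<in> {..<k}" "j \<in> {..<k}" "col B i = col B j"
    have "col (L * B) i = col (L * B) j" using B L ij by simp
    then have "unit_vec k i = (unit_vec k j :: 'a vec)" using ij by (simp add: LB)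
    then show "i = j" using ij by (metis index_unit_vec(1) lessThan_iff zero_neq_one)
  qed
  then show distinct: "distinct (cols B)"
    using B by (simp add: cols_def distinct_map atLeast0LessThan)
  show "lin_indpt (set (cols B))"
  proof
    assume "lin_dep (set (cols B))"
    then obtain v where v: "v \<in> carrier_vec k" "v \<noteq> 0\<^sub>v k" "B *\<^sub>v v = 0\<^sub>v n"
      using lin_depE[OF B _ distinct] by metis
    have "v = (L * B) *\<^sub>v v" using v by (simp add: LB)
    also have "\<dots> = L *\<^sub>v (B *\<^sub>v v)" using L B v by simp
    also have "\<dots> = 0\<^sub>v k" using L v by auto
    finally show False using v by simp
  qed
qed

section \<open>Partial sums of a singular value decomposition\<close>

lemma index_finsum_mat:
  fixes f :: "'b \<Rightarrow> 'a :: field mat"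
  assumes "finite F" and "\<And>x. x \<in> F \<Longrightarrow> f x \<in> carrier_mat m n" and "i < m" "j < n"
  shows "(\<Oplus>\<^bsub>module_mat TYPE('a) m n\<^esub> x \<in> F. f x) $$ (i, j) = (\<Sum>x \<in> F. f x $$ (i, j))"
proof -
  interpret abelian_group "module_mat TYPE('a) m n" by (rule abelian_group_mat)
  show ?thesis using assms(1,2)
  proof (induction F)
    case empty
    then show ?case using assms by (simp add: module_mat_simps)
  next
    case (insert x F)
    have "(\<Oplus>\<^bsub>module_mat TYPE('a) m n\<^esub> x \<in> F. f x) \<in> carrier_mat m n"
      using finsum_closed[of f F] insert.prems by (auto simp: module_mat_simps)
    with insert assms(3,4) show ?case
      by (subst finsum_insert) (auto simp: module_mat_simps)
  qed
qed

lemma finsum_mat_closed: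
  fixes f :: "'b \<Rightarrow> 'a :: field mat"
  assumes "\<And>x. x \<in> F \<Longrightarrow> f x \<in> carrier_mat m n"
  shows "(\<Oplus>\<^bsub>module_mat TYPE('a) m n\<^esub> x \<in> F. f x) \<in> carrier_mat m n"
proof -
  interpret abelian_group "module_mat TYPE('a) m n" by (rule abelian_group_mat)
  show ?thesis
    using finsum_closed[of f F] assms by (auto simp: module_mat_simps)
qed

locale svd =
  fixes m n :: nat and A U V :: "'a :: {conjugatable_field, real_algebra_1} mat" and S :: "real mat"
  assumes A: "A \<in> carrier_mat m n" and svd: "is_svd A U S V"
begin

abbreviation \<sigma> :: "nat \<Rightarrow> 'a" where
  "\<sigma> i \<equiv> of_real (S $$ (i, i))"

abbreviation rank_one_term :: "nat \<Rightarrow> 'a mat" where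
  "rank_one_term i \<equiv> \<sigma> i \<cdot>\<^sub>m outer_prod (col U i) (col V i)"

definition D :: "nat set \<Rightarrow> 'a mat" where
  "D I = mat_diag (card I) (\<lambda>a. \<sigma> (pick I a))"

definition partial_sum :: "nat set \<Rightarrow> 'a mat" where
  "partial_sum I = submatrix U UNIV I * D I * mat_adjoint (submatrix V UNIV I)"

lemma U: "unitary_mat m U" and V: "unitary_mat n V" and S: "S \<in> carrier_mat m n"
  and A_eq: "A = U * map_mat of_real S * mat_adjoint V"
  using A svd by (auto simp: is_svd_def)

lemma carrier [simp]: "U \<in> carrier_mat m m" "V \<in> carrier_mat n n" "D I \<in> carrier_mat (card I) (card I)"
  using U V by (auto simp: unitary_mat_def D_def)

lemma dims [simp]: "dim_row U = m" "dim_col U = m" "dim_row V = n" "dim_col V = n"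
  "dim_row A = m" "dim_col A = n" "dim_row S = m" "dim_col S = n"
  using carrier(1,2) A S by (auto simp only: carrier_matD)

lemma S_off_diagonal: "i < m \<Longrightarrow> j < n \<Longrightarrow> i \<noteq> j \<Longrightarrow> S $$ (i, j) = 0"
  using svd by (auto simp: is_svd_def diagonal_mat_def)

lemma carrier_cols [simp]:
  assumes "I \<subseteq> {..<min m n}"
  shows "submatrix U UNIV I \<in> carrier_mat m (card I)"
    and "submatrix V UNIV I \<in> carrier_mat n (card I)"
    and "mat_adjoint (submatrix U UNIV I) \<in> carrier_mat (card I) m"
    and "mat_adjoint (submatrix V UNIV I) \<in> carrier_mat (card I) n"
proof -
  have "I \<subseteq> {..<m}" "I \<subseteq> {..<n}" using assms by auto
  then show "submatrix U UNIV I \<in> carrier_mat m (card I)"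
    and "submatrix V UNIV I \<in> carrier_mat n (card I)"
    by (simp_all add: submatrix_cols_eq[of _ m m] submatrix_cols_eq[of _ n n])
  then show "mat_adjoint (submatrix U UNIV I) \<in> carrier_mat (card I) m"
    and "mat_adjoint (submatrix V UNIV I) \<in> carrier_mat (card I) n"
    by auto
qed

lemma A_mult_V: "A * V = U * map_mat of_real S"
proof -
  have "A * V = U * map_mat of_real S * (mat_adjoint V * V)"
    unfolding A_eq using S by (intro assoc_mult_mat[of _ m n _ n _ n]) auto
  also have "mat_adjoint V * V = 1\<^sub>m n" using V by (simp add: unitary_mat_def)
  also have "U * map_mat of_real S * 1\<^sub>m n = U * map_mat of_real S"
    using S by (intro right_mult_one_mat[of _ m n]) auto
  finally show ?thesis .
qed

lemma adjoint_U_mult_A: "mat_adjoint U * A = map_mat of_real S * mat_adjoint V"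
proof -
  have "A = U * (map_mat of_real S * mat_adjoint V)"
    unfolding A_eq using S by (intro assoc_mult_mat[of _ m m _ n _ n]) auto
  then have "mat_adjoint U * A = mat_adjoint U * (U * (map_mat of_real S * mat_adjoint V))"
    by simp
  also have "\<dots> = mat_adjoint U * U * (map_mat of_real S * mat_adjoint V)"
    using S by (intro assoc_mult_mat[of _ m m _ m _ n, symmetric]) auto
  also have "mat_adjoint U * U = 1\<^sub>m m" using U by (simp add: unitary_mat_def)
  also have "1\<^sub>m m * (map_mat of_real S * mat_adjoint V) = map_mat of_real S * mat_adjoint V"
    using S by (intro left_mult_one_mat[of _ m n]) auto
  finally show ?thesis .
qed

lemma U_mult_S_index:
  assumes "i < m" "j < min m n"
  shows "(U * map_mat of_real S) $$ (i, j) = U $$ (i, j) * \<sigma> j"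
proof -
  have "(U * map_mat of_real S) $$ (i, j) = (\<Sum>k<m. U $$ (i, k) * of_real (S $$ (k, j)))"
    using assms by (simp add: scalar_prod_def atLeast0LessThan)
  also have "\<dots> = (\<Sum>k<m. if k = j then U $$ (i, j) * \<sigma> j else 0)"
    using assms by (intro sum.cong) (auto simp: S_off_diagonal)
  also have "\<dots> = U $$ (i, j) * \<sigma> j" using assms by simp
  finally show ?thesis .
qed

lemma S_mult_V_index:
  assumes "i < min m n" "j < n"
  shows "(map_mat of_real S * mat_adjoint V) $$ (i, j) = \<sigma> i * conjugate (V $$ (j, i))"
proof -
  have "(map_mat of_real S * mat_adjoint V) $$ (i, j)
      = (\<Sum>k<n. of_real (S $$ (i, k)) * conjugate (V $$ (j, k)))"
    using assms by (simp add: scalar_prod_def atLeast0LessThan)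
  also have "\<dots> = (\<Sum>k<n. if k = i then \<sigma> i * conjugate (V $$ (j, i)) else 0)"
    using assms by (intro sum.cong) (auto simp: S_off_diagonal)
  also have "\<dots> = \<sigma> i * conjugate (V $$ (j, i))" using assms by simp
  finally show ?thesis .
qed

lemma A_mult_V_cols:
  assumes I: "I \<subseteq> {..<min m n}"
  shows "A * submatrix V UNIV I = submatrix U UNIV I * D I"
proof (rule eq_matI)
  have In: "I \<subseteq> {..<n}" and Im: "I \<subseteq> {..<m}" using I by auto
  note subs = submatrix_cols_eq[OF carrier(1) Im] submatrix_cols_eq[OF carrier(2) In]
  fix i a assume "i < dim_row (submatrix U UNIV I * D I)" "a < dim_col (submatrix U UNIV I * D I)"
  then have ia: "i < m" "a < card I" by (auto simp: subs D_def mat_diag_def)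
  have p: "pick I a < min m n" using pick_lt[OF I ia(2)] .
  have "(A * submatrix V UNIV I) $$ (i, a) = (A * V) $$ (i, pick I a)"
    using ia p by (auto simp: subs scalar_prod_def intro!: sum.cong)
  also have "\<dots> = U $$ (i, pick I a) * \<sigma> (pick I a)"
    using U_mult_S_index[OF ia(1) p] by (simp add: A_mult_V)
  also have "\<dots> = (submatrix U UNIV I * D I) $$ (i, a)"
    unfolding D_def using ia by (subst mat_diag_mult_right[of _ m]) (auto simp: subs)
  finally show "(A * submatrix V UNIV I) $$ (i, a) = (submatrix U UNIV I * D I) $$ (i, a)" .
qed (use carrier_cols[OF I] in \<open>auto simp: D_def mat_diag_def\<close>)

lemma adjoint_U_cols_mult_A:
  assumes I: "I \<subseteq> {..<min m n}"
  shows "mat_adjoint (submatrix U UNIV I) * A = D I * mat_adjoint (submatrix V UNIV I)"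
proof (rule eq_matI)
  have In: "I \<subseteq> {..<n}" and Im: "I \<subseteq> {..<m}" using I by auto
  note subs = submatrix_cols_eq[OF carrier(1) Im] submatrix_cols_eq[OF carrier(2) In]
  fix a j assume "a < dim_row (D I * mat_adjoint (submatrix V UNIV I))"
    "j < dim_col (D I * mat_adjoint (submatrix V UNIV I))"
  then have aj: "a < card I" "j < n" by (auto simp: subs D_def mat_diag_def)
  have p: "pick I a < min m n" using pick_lt[OF I aj(1)] .
  have "(mat_adjoint (submatrix U UNIV I) * A) $$ (a, j) = (mat_adjoint U * A) $$ (pick I a, j)"
    using aj p by (auto simp: subs scalar_prod_def intro!: sum.cong)
  also have "\<dots> = \<sigma> (pick I a) * conjugate (V $$ (j, pick I a))"
    using S_mult_V_index[OF p aj(2)] by (simp add: adjoint_U_mult_A)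
  also have "\<dots> = (D I * mat_adjoint (submatrix V UNIV I)) $$ (a, j)"
    unfolding D_def using aj by (subst mat_diag_mult_left[of _ _ n]) (auto simp: subs)
  finally show "(mat_adjoint (submatrix U UNIV I) * A) $$ (a, j)
      = (D I * mat_adjoint (submatrix V UNIV I)) $$ (a, j)" .
qed (use carrier_cols[OF I] in \<open>auto simp: D_def mat_diag_def\<close>)

lemma D_inverse:
  assumes nz: "\<And>i. i \<in> I \<Longrightarrow> S $$ (i, i) \<noteq> 0"
  obtains E where "E \<in> carrier_mat (card I) (card I)" "D I * E = 1\<^sub>m (card I)" "E * D I = 1\<^sub>m (card I)"
proof
  let ?E = "mat_diag (card I) (\<lambda>a. inverse (\<sigma> (pick I a)))"
  have "\<sigma> (pick I a) \<noteq> 0" if "a < card I" for a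
    using nz pick_in_set_le[OF that] by simp
  then show "D I * ?E = 1\<^sub>m (card I)" "?E * D I = 1\<^sub>m (card I)"
    by (auto simp: D_def mat_diag_def[of _ "\<lambda>i. _ i * _ i"] intro!: eq_matI)
qed simp

lemma partial_sum_index:
  assumes I: "I \<subseteq> {..<min m n}" and ij: "i < m" "j < n"
  shows "partial_sum I $$ (i, j) = (\<Sum>k\<in>I. U $$ (i, k) * \<sigma> k * conjugate (V $$ (j, k)))"
proof -
  have In: "I \<subseteq> {..<n}" and Im: "I \<subseteq> {..<m}" and fin: "finite I"
    using I by (auto intro: finite_subset)
  note subs = submatrix_cols_eq[OF carrier(1) Im] submatrix_cols_eq[OF carrier(2) In]
  have "partial_sum I $$ (i, j)
      = (\<Sum>a<card I. U $$ (i, pick I a) * \<sigma> (pick I a) * conjugate (V $$ (j, pick I a)))"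
    unfolding partial_sum_def D_def using ij
    by (subst mat_diag_mult_right[of _ m])
       (auto simp: subs scalar_prod_def atLeast0LessThan intro!: sum.cong)
  also have "\<dots> = (\<Sum>k\<in>I. U $$ (i, k) * \<sigma> k * conjugate (V $$ (j, k)))"
    by (rule sum.reindex_bij_betw[OF bij_betw_pick[OF fin]])
  finally show ?thesis .
qed

lemma partial_sum_carrier:
  assumes "I \<subseteq> {..<min m n}"
  shows "partial_sum I \<in> carrier_mat m n"
  unfolding partial_sum_def using assms by (intro mult_carrier_mat[of _ _ "card I"]) simp_all

lemma rank_one_term_carrier: "rank_one_term k \<in> carrier_mat m n"
  by (auto simp: outer_prod_def)

lemma rank_one_term_index:
  assumes "k < min m n" "i < m" "j < n"
  shows "rank_one_term k $$ (i, j) = U $$ (i, k) * \<sigma> k * conjugate (V $$ (j, k))"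
  using assms by (simp add: outer_prod_def scalar_prod_def mat_of_cols_def)

lemma partial_sum_eq_finsum:
  assumes I: "I \<subseteq> {..<min m n}"
  shows "partial_sum I = (\<Oplus>\<^bsub>module_mat TYPE('a) m n\<^esub> k \<in> I. rank_one_term k)" (is "_ = ?R")
proof (rule eq_matI)
  have R: "?R \<in> carrier_mat m n" by (intro finsum_mat_closed rank_one_term_carrier)
  then show "dim_row (partial_sum I) = dim_row ?R" "dim_col (partial_sum I) = dim_col ?R"
    using partial_sum_carrier[OF I] by auto
  fix i j assume "i < dim_row ?R" "j < dim_col ?R"
  then have ij: "i < m" "j < n" using R by auto
  have "finite I" using I finite_subset by blast
  then have "?R $$ (i, j) = (\<Sum>k\<in>I. rank_one_term k $$ (i, j))"
    using ij by (intro index_finsum_mat rank_one_term_carrier) auto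
  also have "\<dots> = partial_sum I $$ (i, j)"
    unfolding partial_sum_index[OF I ij] using I ij
    by (intro sum.cong refl rank_one_term_index) auto
  finally show "partial_sum I $$ (i, j) = ?R $$ (i, j)" by simp
qed

section \<open>The rank counts the nonzero singular values\<close>

definition support :: "nat set" where
  "support = {i. i < min m n \<and> S $$ (i, i) \<noteq> 0}"

lemma support_subset: "support \<subseteq> {..<min m n}"
  by (auto simp: support_def)

lemma A_eq_partial_sum: "A = partial_sum support"
proof (rule eq_matI)
  note P = partial_sum_carrier[OF support_subset]
  then show "dim_row A = dim_row (partial_sum support)" "dim_col A = dim_col (partial_sum support)"
    by auto
  fix i j assume "i < dim_row (partial_sum support)" "j < dim_col (partial_sum support)"
  then have ij: "i < m" "j < n" using P by auto
  have "A $$ (i, j) = (\<Sum>k<n. (U * map_mat of_real S) $$ (i, k) * conjugate (V $$ (j, k)))"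
    unfolding A_eq using ij by (auto simp: scalar_prod_def atLeast0LessThan)
  \<comment> \<open>Columns of \<open>U \<Sigma>\<close> outside the support vanish, including those beyond the diagonal of \<open>\<Sigma>\<close>.\<close>
  also have "\<dots> = (\<Sum>k\<in>support. (U * map_mat of_real S) $$ (i, k) * conjugate (V $$ (j, k)))"
  proof (rule sum.mono_neutral_right)
    show "\<forall>k\<in>{..<n} - support. (U * map_mat of_real S) $$ (i, k) * conjugate (V $$ (j, k)) = 0"
    proof
      fix k assume k: "k \<in> {..<n} - support"
      have "(U * map_mat of_real S) $$ (i, k) = (\<Sum>l<m. U $$ (i, l) * of_real (S $$ (l, k)))"
        using ij k by (auto simp: scalar_prod_def atLeast0LessThan)
      also have "\<dots> = 0"
      proof (intro sum.neutral ballI)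
        fix l assume l: "l \<in> {..<m}"
        have "S $$ (l, k) = 0"
          using k l S_off_diagonal[of l k] by (cases "l = k") (auto simp: support_def)
        then show "U $$ (i, l) * of_real (S $$ (l, k)) = 0" by simp
      qed
      finally show "(U * map_mat of_real S) $$ (i, k) * conjugate (V $$ (j, k)) = 0" by simp
    qed
  qed (use support_subset in auto)
  also have "\<dots> = partial_sum support $$ (i, j)"
    unfolding partial_sum_index[OF support_subset ij] using support_subset ij
    by (intro sum.cong refl arg_cong2[of _ _ _ _ "(*)"] U_mult_S_index) auto
  finally show "A $$ (i, j) = partial_sum support $$ (i, j)" .
qed

text \<open>The columns of \<open>U\<close> indexed by the support are an orthonormal basis of the column space of
  \<open>A\<close>: the two matrices are right multiples of each other.\<close>

lemma rank_eq_card_support: "vec_space.rank m A = card support"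
proof -
  interpret vec_space "TYPE('a)" m .
  let ?X = "submatrix V UNIV support" and ?Y = "submatrix U UNIV support"
  note [simp] = carrier_cols[OF support_subset]
  obtain E where E: "E \<in> carrier_mat (card support) (card support)"
    "D support * E = 1\<^sub>m (card support)"
    using D_inverse[of support] by (auto simp: support_def)
  have "A = ?Y * (D support * mat_adjoint ?X)"
    by (subst A_eq_partial_sum, unfold partial_sum_def,
        rule assoc_mult_mat[of _ m "card support" _ "card support" _ n]) simp_all
  moreover have "D support * mat_adjoint ?X \<in> carrier_mat (card support) n"
    by (rule mult_carrier_mat[of _ _ "card support"]) simp_all
  ultimately have AY: "span (set (cols A)) \<subseteq> span (set (cols ?Y))"
    using col_space_mult_subset[of ?Y "card support" "D support * mat_adjoint ?X" n]
    by (metis carrier_cols(1) support_subset)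
  have "?Y = A * (?X * E)"
  proof -
    have "A * (?X * E) = A * ?X * E"
      using A E by (intro assoc_mult_mat[of _ m n _ "card support" _ "card support", symmetric]) auto
    also have "\<dots> = ?Y * D support * E" by (simp add: A_mult_V_cols[OF support_subset])
    also have "\<dots> = ?Y * (D support * E)"
      using E by (intro assoc_mult_mat[of _ m "card support" _ "card support" _ "card support"]) auto
    also have "\<dots> = ?Y"
      unfolding E(2) by (rule right_mult_one_mat[of _ m]) simp
    finally show ?thesis by simp
  qed
  moreover have "?X * E \<in> carrier_mat n (card support)"
    using E by (intro mult_carrier_mat[of _ _ "card support"]) auto
  ultimately have "span (set (cols ?Y)) \<subseteq> span (set (cols A))"
    using col_space_mult_subset[OF A, of "?X * E" "card support"] by metis
  with AY have "rank A = rank ?Y" by (simp add: rank_def)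
  also have "\<dots> = card support"
  proof (rule rank_left_invertible)
    show "mat_adjoint ?Y * ?Y = 1\<^sub>m (card support)"
      using support_subset by (intro unitary_cols_orthonormal[OF U]) auto
  qed simp_all
  finally show ?thesis .
qed

lemma support_eq: "support = {0..<vec_space.rank m A}"
proof -
  \<comment> \<open>A nonzero singular value is positive, so the smaller indices carry positive ones as well.\<close>
  have down: "i \<in> support" if "j \<in> support" "i \<le> j" for i j
  proof -
    have "0 \<le> S $$ (j, j)" "S $$ (j, j) \<le> S $$ (i, i)" "S $$ (j, j) \<noteq> 0" "i < min m n"
      using that svd by (auto simp: support_def is_svd_def)
    then show ?thesis by (auto simp: support_def)
  qed
  have fin: "finite support" using support_subset finite_subset by blast
  have "support \<subseteq> {..<card support}"
  proof
    fix j assume "j \<in> support"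
    then have "{..j} \<subseteq> support" using down by auto
    from card_mono[OF fin this] show "j \<in> {..<card support}" by simp
  qed
  then have "support = {..<card support}" by (intro card_subset_eq) auto
  then show ?thesis by (simp add: rank_eq_card_support atLeast0LessThan)
qed

section \<open>The approximation from selected singular vectors\<close>

text \<open>With \<open>A X = Y D\<close>, the core \<open>Y\<^sup>* A X\<close> is the invertible matrix \<open>D\<close>, whose pseudoinverse
  cancels the factor \<open>D\<close> of \<open>A X\<close>.\<close>

lemma cross_approx_eq_partial_sum:
  assumes I: "I \<subseteq> support"
    and X: "X = submatrix V UNIV I" and Y: "Y = submatrix U UNIV I"
  shows "A * X * pinv (mat_adjoint Y * A * X) * mat_adjoint Y * A = partial_sum I"
proof -
  let ?k = "card I"
  have Imn: "I \<subseteq> {..<min m n}" using I support_subset by auto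
  note [simp] = carrier_cols[OF Imn, folded X Y]
  note AX = A_mult_V_cols[OF Imn, folded X Y]
    and YA = adjoint_U_cols_mult_A[OF Imn, folded X Y]
  obtain E where E: "E \<in> carrier_mat ?k ?k" "D I * E = 1\<^sub>m ?k" "E * D I = 1\<^sub>m ?k"
    using D_inverse[of I] I by (auto simp: support_def)
  have "mat_adjoint Y * A * X = mat_adjoint Y * (A * X)"
    using A by (intro assoc_mult_mat[of _ ?k m _ n _ ?k]) auto
  also have "\<dots> = mat_adjoint Y * Y * D I"
    unfolding AX by (intro assoc_mult_mat[of _ ?k m _ ?k _ ?k, symmetric]) auto
  also have "mat_adjoint Y * Y = 1\<^sub>m ?k"
    unfolding Y using Imn by (intro unitary_cols_orthonormal[OF U]) auto
  also have "1\<^sub>m ?k * D I = D I" by (rule left_mult_one_mat[OF carrier(3)])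
  finally have "mat_adjoint Y * A * X = D I" .
  with pinv_eq_inverse[OF carrier(3) E] have "pinv (mat_adjoint Y * A * X) = E" by simp
  then have "A * X * pinv (mat_adjoint Y * A * X) * mat_adjoint Y * A
      = Y * D I * E * mat_adjoint Y * A"
    by (simp add: AX)
  also have "Y * D I * E = Y * (D I * E)"
    using E by (intro assoc_mult_mat[of _ m ?k _ ?k _ ?k]) auto
  also have "\<dots> = Y" unfolding E(2) by (rule right_mult_one_mat[of _ m]) simp
  also have "Y * mat_adjoint Y * A = Y * (D I * mat_adjoint X)"
    unfolding YA[symmetric] using A by (intro assoc_mult_mat[of _ m ?k _ m _ n]) auto
  also have "\<dots> = partial_sum I"
    unfolding partial_sum_def X[symmetric] Y[symmetric]
    by (intro assoc_mult_mat[of _ m ?k _ ?k _ n, symmetric]) auto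
  finally show ?thesis .
qed

lemma diff_partial_sum:
  assumes I: "I \<subseteq> support"
  shows "A - partial_sum I = partial_sum (support - I)"
proof (rule eq_matI)
  have Imn: "I \<subseteq> {..<min m n}" "support - I \<subseteq> {..<min m n}" using I support_subset by auto
  note P = partial_sum_carrier[OF Imn(1)] partial_sum_carrier[OF Imn(2)]
  then show "dim_row (A - partial_sum I) = dim_row (partial_sum (support - I))"
    "dim_col (A - partial_sum I) = dim_col (partial_sum (support - I))" by auto
  fix i j assume "i < dim_row (partial_sum (support - I))" "j < dim_col (partial_sum (support - I))"
  then have ij: "i < m" "j < n" using P by auto
  have "A $$ (i, j) = partial_sum support $$ (i, j)" using A_eq_partial_sum by simp
  also have "\<dots> = partial_sum (support - I) $$ (i, j) + partial_sum I $$ (i, j)"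
    unfolding partial_sum_index[OF support_subset ij] partial_sum_index[OF Imn(1) ij]
      partial_sum_index[OF Imn(2) ij]
    using I support_subset by (intro sum.subset_diff) (auto intro: finite_subset)
  finally show "(A - partial_sum I) $$ (i, j) = partial_sum (support - I) $$ (i, j)"
    using ij P by simp
qed

lemma cross_approx_eq_finsum:
  assumes r: "r = vec_space.rank m A" and I: "I \<subseteq> {0..<r}"
    and X: "X = submatrix V UNIV I" and Y: "Y = submatrix U UNIV I"
  shows "A * X * pinv (mat_adjoint Y * A * X) * mat_adjoint Y * A
      = (\<Oplus>\<^bsub>module_mat TYPE('a) m n\<^esub> i \<in> I. rank_one_term i)" (is "?P = _")
    and "A - A * X * pinv (mat_adjoint Y * A * X) * mat_adjoint Y * A
      = (\<Oplus>\<^bsub>module_mat TYPE('a) m n\<^esub> i \<in> {0..<r} - I. rank_one_term i)"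
proof -
  have supp: "support = {0..<r}" unfolding r by (rule support_eq)
  have I': "I \<subseteq> support" using I by (simp add: supp)
  have P: "?P = partial_sum I" by (rule cross_approx_eq_partial_sum[OF I' X Y])
  then show "?P = (\<Oplus>\<^bsub>module_mat TYPE('a) m n\<^esub> i \<in> I. rank_one_term i)"
    using I' support_subset by (subst partial_sum_eq_finsum[symmetric]) auto
  have "support - I \<subseteq> {..<min m n}" using support_subset by auto
  from partial_sum_eq_finsum[OF this]
  show "A - ?P = (\<Oplus>\<^bsub>module_mat TYPE('a) m n\<^esub> i \<in> {0..<r} - I. rank_one_term i)"
    unfolding P diff_partial_sum[OF I'] by (simp add: supp)
qed

end

theorem lemma7p1:
  shows "(\<forall>m n r (A :: real mat) U S V I X Y.
      A \<in> carrier_mat m n \<longrightarrow> is_svd A U S V \<longrightarrow> r = vec_space.rank m A \<longrightarrow>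
      I \<subseteq> {0..<r} \<longrightarrow> I \<noteq> {} \<longrightarrow> X = submatrix V UNIV I \<longrightarrow> Y = submatrix U UNIV I \<longrightarrow>
        A * X * pinv (mat_adjoint Y * A * X) * mat_adjoint Y * A
          = (\<Oplus>\<^bsub>module_mat TYPE(real) m n\<^esub> i \<in> I.
               S $$ (i, i) \<cdot>\<^sub>m outer_prod (col U i) (col V i)) \<and>
        A - A * X * pinv (mat_adjoint Y * A * X) * mat_adjoint Y * A
          = (\<Oplus>\<^bsub>module_mat TYPE(real) m n\<^esub> i \<in> {0..<r} - I.
               S $$ (i, i) \<cdot>\<^sub>m outer_prod (col U i) (col V i)))
    \<and>
    (\<forall>m n r (A :: complex mat) U S V I X Y.
      A \<in> carrier_mat m n \<longrightarrow> is_svd A U S V \<longrightarrow> r = vec_space.rank m A \<longrightarrow>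
      I \<subseteq> {0..<r} \<longrightarrow> I \<noteq> {} \<longrightarrow> X = submatrix V UNIV I \<longrightarrow> Y = submatrix U UNIV I \<longrightarrow>
        A * X * pinv (mat_adjoint Y * A * X) * mat_adjoint Y * A
          = (\<Oplus>\<^bsub>module_mat TYPE(complex) m n\<^esub> i \<in> I.
               complex_of_real (S $$ (i, i)) \<cdot>\<^sub>m outer_prod (col U i) (col V i)) \<and>
        A - A * X * pinv (mat_adjoint Y * A * X) * mat_adjoint Y * A
          = (\<Oplus>\<^bsub>module_mat TYPE(complex) m n\<^esub> i \<in> {0..<r} - I.
               complex_of_real (S $$ (i, i)) \<cdot>\<^sub>m outer_prod (col U i) (col V i)))"
proof (intro conjI[of "\<forall>m. _ m"] allI impI)
  fix m n r :: nat and A :: "real mat" and U S V I X Y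
  assume H: "A \<in> carrier_mat m n" "is_svd A U S V" "r = vec_space.rank m A" "I \<subseteq> {0..<r}"
    "X = submatrix V UNIV I" "Y = submatrix U UNIV I"
  interpret svd m n A U V S by (rule svd.intro) (use H(1,2) in simp_all)
  show "A * X * pinv (mat_adjoint Y * A * X) * mat_adjoint Y * A
          = (\<Oplus>\<^bsub>module_mat TYPE(real) m n\<^esub> i \<in> I.
               S $$ (i, i) \<cdot>\<^sub>m outer_prod (col U i) (col V i)) \<and>
        A - A * X * pinv (mat_adjoint Y * A * X) * mat_adjoint Y * A
          = (\<Oplus>\<^bsub>module_mat TYPE(real) m n\<^esub> i \<in> {0..<r} - I.
               S $$ (i, i) \<cdot>\<^sub>m outer_prod (col U i) (col V i))"
    using cross_approx_eq_finsum[OF H(3-6)] by (simp only: of_real_eq_id id_apply)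
next
  fix m n r :: nat and A :: "complex mat" and U S V I X Y
  assume H: "A \<in> carrier_mat m n" "is_svd A U S V" "r = vec_space.rank m A" "I \<subseteq> {0..<r}"
    "X = submatrix V UNIV I" "Y = submatrix U UNIV I"
  interpret svd m n A U V S by (rule svd.intro) (use H(1,2) in simp_all)
  show "A * X * pinv (mat_adjoint Y * A * X) * mat_adjoint Y * A
          = (\<Oplus>\<^bsub>module_mat TYPE(complex) m n\<^esub> i \<in> I.
               complex_of_real (S $$ (i, i)) \<cdot>\<^sub>m outer_prod (col U i) (col V i)) \<and>
        A - A * X * pinv (mat_adjoint Y * A * X) * mat_adjoint Y * A
          = (\<Oplus>\<^bsub>module_mat TYPE(complex) m n\<^esub> i \<in> {0..<r} - I.
               complex_of_real (S $$ (i, i)) \<cdot>\<^sub>m outer_prod (col U i) (col V i))"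
    using cross_approx_eq_finsum[OF H(3-6)] by simp
qed

end
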